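(* Let $M$ be a compact connected Riemann surface of genus $q\ge 1$. For any two normalized volume forms $\omega_1$ and $\omega_2$ on $M$ and any two distinct points $P\neq Q$ of $M$, there is a natural isometry (given by the identity of the Deligne pairing $\langle \mathcal O_M(P),\mathcal O_M(Q)\rangle$) $$\langle \underline{\mathcal O_M(P)}_{\omega_1},\underline{\mathcal O_M(Q)}_{\omega_1}\rangle\simeq\langle \underline{\mathcal O_M(P)}_{\omega_2},\underline{\mathcal O_M(Q)}_{\omega_2}\rangle ,$$ where the left side carries the $\omega_1$-Deligne norm and the right side the $\omega_2$-Deligne norm.
   Context: $K_M$ is the canonical line bundle of $M$ and $d(L)$ the degree of a line bundle $L$. For a finite set $\{P_1,\dots,P_N\}\subset M$ (the cusps) and $M^0=M\setminus\{P_1,\dots,P_N\}$, a Hermitian metric $ds^2$ on $M^0$ is quasi-hyperbolic if near each $P_i$ there are a punctured coordinate disc $\Delta^*=\{0<|z|<1\}$ centered at $P_i$, constants $C_1,C_2,C_3>0$ and a function $\phi_i$ on $\Delta^*$ with $ds^2=\frac{\partial^2\phi_i}{\partial z\partial\bar z}dz\otimes d\bar z$, $ds^2\le C_1|dz|^2/(|z|^2(\log|z|)^2)$, $|\phi_i|\le C_2\max\{1,\log(-\log|z|)\}$ and $|\partial\phi_i/\partial z|,|\partial\phi_i/\partial\bar z|\le C_3/(|z|\,|\log|z||)$. A normalized volume form $\omega$ on $M$ is the volume form of a smooth metric on $M$, or of a quasi-hyperbolic metric on the complement $M^0$ of a finite set, scaled so that $\int_M\omega=1$. Put $d^c=\frac{\sqrt{-1}}{4\pi}(\bar\partial-\partial)$,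 so $dd^c=\frac{\sqrt{-1}}{2\pi}\partial\bar\partial$. The canonical volume form is $\omega_{\rm can}=\frac{\sqrt{-1}}{2q}\sum_{j=1}^q\phi_j\wedge\bar\phi_j$, $\{\phi_j\}$ an orthonormal basis of $H^0(M,K_M)$ for $(\phi,\psi)\mapsto\frac{\sqrt{-1}}2\int_M\phi\wedge\bar\psi$. $g(P,Q)$ is the Arakelov–Green function: symmetric, smooth off the diagonal, $g(P,Q)=-\log|f(Q)|^2+$ smooth near $P$ ($f$ a local equation of $P$), $d_Qd_Q^cg(P,Q)=\omega_{\rm can}-\delta_P$, $\int_Mg(P,\cdot)\omega_{\rm can}=0$. $\beta_\omega$ is the unique locally integrable function on $M$ with $dd^c\beta_\omega=\omega-\omega_{\rm can}$ and $\int_M\beta_\omega(\omega+\omega_{\rm can})=0$. The $\omega$-Arakelov metric on $\mathcal O_M(P)$ is given by $\log\|1_P\|^2(Q)=-g(P,Q)-\beta_\omega(Q)$, $1_P$ the defining section; $\underline{\mathcal O_M(P)}_\omega$ denotes $\mathcal O_M(P)$ with this metric. A Hermitian line bundle $(L,\rho)$ is $\omega$-admissible if $c_1(L,\rho)=d(L)\,\omega$ (as currents on $M$; metrics may be singular at cusps). The Deligne pairing $\langle L,L'\rangle$ is the complex line generated by symbols $\langle \ell,m\rangle$, for rational sections $\ell,m$ of $L,L'$ with disjoint divisors, with $\langle f\ell,m\rangle=f(\mathrm{div}\,m)\langle\ell,m\rangle$, $\langle\ell,fm\rangle=f(\mathrm{div}\,\ell)\langle\ell,m\rangle$. The $\omega$-Deligne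 norm is the one with $\log\|\langle 1_P,1_Q\rangle\|^2=-g(P,Q)$ for $P\ne Q$, extended bilinearly to all $\omega$-admissible Hermitian line bundles: if $\mathrm{div}\,\ell=\sum n_iA_i$, $\mathrm{div}\,m=\sum m_jB_j$ are disjoint, $\|\ell\|^2=e^{c}\prod\|1_{A_i}\|^{2n_i}$ and $\|m\|^2=e^{c'}\prod\|1_{B_j}\|^{2m_j}$, then $\log\|\langle\ell,m\rangle\|^2=-\sum n_im_jg(A_i,B_j)+c\,d(L')+c'\,d(L)$. *)

theory Defs
  imports "HOL-Complex_Analysis.Complex_Analysis" "HOL-Library.Poly_Mapping"
begin

section \<open>Riemann surfaces\<close>

text \<open>
  The points of the surface are the elements of a Hausdorff type; the complex structure is
  an atlas. A chart is a pair of a domain and a coordinate function, whose values outside the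
  domain are irrelevant. Second countability follows from compactness.
\<close>

type_synonym 'a chart = "'a set \<times> ('a \<Rightarrow> complex)"

definition chart_image :: "'a chart \<Rightarrow> complex set" where
  "chart_image c = snd c ` fst c"

definition chart_inv :: "'a chart \<Rightarrow> complex \<Rightarrow> 'a" where
  "chart_inv c = inv_into (fst c) (snd c)"

definition is_chart :: "('a :: topological_space) chart \<Rightarrow> bool" where
  "is_chart c \<longleftrightarrow> open (fst c) \<and> open (chart_image c) \<and>
     homeomorphism (fst c) (chart_image c) (snd c) (chart_inv c)"

definition chart_compatible :: "'a chart \<Rightarrow> 'a chart \<Rightarrow> bool" where
  "chart_compatible c d \<longleftrightarrow>
     (snd d \<circ> chart_inv c) holomorphic_on (snd c ` (fst c \<inter> fst d)) \<and>
     (snd c \<circ> chart_inv d) holomorphic_on (snd d ` (fst c \<inter> fst d))"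

definition riemann_surface :: "('a :: t2_space) chart set \<Rightarrow> bool" where
  "riemann_surface A \<longleftrightarrow>
     (\<forall>c\<in>A. is_chart c) \<and> (\<Union>c\<in>A. fst c) = UNIV \<and> (\<forall>c\<in>A. \<forall>d\<in>A. chart_compatible c d)"

definition compact_connected_riemann_surface :: "('a :: t2_space) chart set \<Rightarrow> bool" where
  "compact_connected_riemann_surface A \<longleftrightarrow>
     riemann_surface A \<and> compact (UNIV :: 'a set) \<and> connected (UNIV :: 'a set)"

text \<open>All holomorphic coordinates, i.e. the maximal atlas containing \<open>A\<close>.\<close>

definition coords :: "('a :: t2_space) chart set \<Rightarrow> 'a chart set" where
  "coords A = {c. is_chart c \<and> (\<forall>d\<in>A. chart_compatible c d)}"

text \<open>The derivative \<open>dw/dz\<close> at \<open>p\<close>, for \<open>z\<close> the coordinate of \<open>c\<close> and \<open>w\<close> the one of \<open>d\<close>.\<close>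

definition transition_deriv :: "'a chart \<Rightarrow> 'a chart \<Rightarrow> 'a \<Rightarrow> complex" where
  "transition_deriv c d p = deriv (snd d \<circ> chart_inv c) (snd c p)"

section \<open>Smooth functions\<close>

text \<open>These are meant for open sets \<open>S\<close>.\<close>

primrec Ck_on :: "nat \<Rightarrow> ('b :: euclidean_space \<Rightarrow> 'c :: real_normed_vector) \<Rightarrow> 'b set \<Rightarrow> bool" where
  "Ck_on 0 f S \<longleftrightarrow> continuous_on S f"
| "Ck_on (Suc k) f S \<longleftrightarrow> (\<forall>x\<in>S. f differentiable (at x)) \<and>
     (\<forall>b\<in>Basis. Ck_on k (\<lambda>x. frechet_derivative f (at x) b) S)"

definition smooth_on :: "('b :: euclidean_space \<Rightarrow> 'c :: real_normed_vector) \<Rightarrow> 'b set \<Rightarrow> bool" where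
  "smooth_on f S \<longleftrightarrow> (\<forall>k. Ck_on k f S)"

definition smooth_function :: "('a :: t2_space) chart set \<Rightarrow> ('a \<Rightarrow> real) \<Rightarrow> bool" where
  "smooth_function A f \<longleftrightarrow> (\<forall>c\<in>coords A. smooth_on (f \<circ> chart_inv c) (chart_image c))"

definition d_dz :: "(complex \<Rightarrow> complex) \<Rightarrow> complex \<Rightarrow> complex" where
  "d_dz f z = (frechet_derivative f (at z) 1 - \<i> * frechet_derivative f (at z) \<i>) / 2"

definition d_dzbar :: "(complex \<Rightarrow> complex) \<Rightarrow> complex \<Rightarrow> complex" where
  "d_dzbar f z = (frechet_derivative f (at z) 1 + \<i> * frechet_derivative f (at z) \<i>) / 2"

section \<open>Differential forms and integration\<close>

text \<open>
  A form is given by its coefficients in all holomorphic coordinates: a \<open>(1,0)\<close>-form \<open>\<phi>\<close> is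
  \<open>\<phi> c p dz\<close>, and a \<open>(1,1)\<close>-form \<open>\<eta>\<close> is \<open>\<eta> c p (i/2) dz \<and> dzbar = \<eta> c p dx \<and> dy\<close>, where
  \<open>z = x + i y\<close> is the coordinate of the chart \<open>c\<close>. Only the values at points \<open>p\<close> of the
  domain of \<open>c\<close> matter.
\<close>

type_synonym ('a, 'v) form = "'a chart \<Rightarrow> 'a \<Rightarrow> 'v"

text \<open>
  The integral of a \<open>(1,1)\<close>-form, computed by cutting the surface into finitely many Borel
  pieces, each contained in the domain of one coordinate.
\<close>

definition form_has_integral ::
  "('a :: t2_space) chart set \<Rightarrow> ('a, 'v :: {banach, second_countable_topology}) form \<Rightarrow> 'v \<Rightarrow> bool" where
  "form_has_integral A \<eta> I \<longleftrightarrow> (\<exists>D :: ('a chart \<times> 'a set) set.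
     finite D \<and>
     (\<forall>(c, E)\<in>D. c \<in> coords A \<and> E \<in> sets borel \<and> E \<subseteq> fst c) \<and>
     (\<forall>X\<in>D. \<forall>Y\<in>D. X \<noteq> Y \<longrightarrow> snd X \<inter> snd Y = {}) \<and>
     (\<Union>X\<in>D. snd X) = UNIV \<and>
     (\<forall>(c, E)\<in>D. set_integrable lebesgue (snd c ` E) (\<lambda>z. \<eta> c (chart_inv c z))) \<and>
     I = (\<Sum>(c, E)\<in>D. set_lebesgue_integral lebesgue (snd c ` E) (\<lambda>z. \<eta> c (chart_inv c z))))"

definition form_integral ::
  "('a :: t2_space) chart set \<Rightarrow> ('a, 'v :: {banach, second_countable_topology}) form \<Rightarrow> 'v" where
  "form_integral A \<eta> = (THE I. form_has_integral A \<eta> I)"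

definition locally_integrable :: "('a :: t2_space) chart set \<Rightarrow> ('a \<Rightarrow> real) \<Rightarrow> bool" where
  "locally_integrable A u \<longleftrightarrow> (\<forall>c\<in>coords A. \<forall>K. compact K \<and> K \<subseteq> chart_image c \<longrightarrow>
     set_integrable lebesgue K (u \<circ> chart_inv c))"

text \<open>
  With \<open>dd\<^sup>c = (i / 2\<pi>) \<partial>\<partial>bar\<close>, the form \<open>dd\<^sup>c \<tau>\<close> is
  \<open>(1/\<pi>) (\<partial>\<^sup>2\<tau> / \<partial>z \<partial>zbar) (i/2) dz \<and> dzbar\<close>; the second derivative is real for real \<open>\<tau>\<close>.
\<close>

definition ddc :: "('a \<Rightarrow> real) \<Rightarrow> ('a, real) form" where
  "ddc \<tau> c p = Re (d_dz (d_dzbar (\<lambda>z. complex_of_real (\<tau> (chart_inv c z)))) (snd c p)) / pi"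

text \<open>The equation \<open>dd\<^sup>c u = T\<close> of currents of degree 2, a current being its action on test functions.\<close>

definition has_ddc_current ::
  "('a :: t2_space) chart set \<Rightarrow> ('a \<Rightarrow> real) \<Rightarrow> (('a \<Rightarrow> real) \<Rightarrow> real) \<Rightarrow> bool" where
  "has_ddc_current A u T \<longleftrightarrow>
     (\<forall>\<tau>. smooth_function A \<tau> \<longrightarrow> form_has_integral A (\<lambda>c p. u p * ddc \<tau> c p) (T \<tau>))"

section \<open>Holomorphic differentials and the canonical volume form\<close>

definition holomorphic_differential :: "('a :: t2_space) chart set \<Rightarrow> ('a, complex) form \<Rightarrow> bool" where
  "holomorphic_differential A \<phi> \<longleftrightarrow> (\<forall>c\<in>coords A.
     (\<phi> c \<circ> chart_inv c) holomorphic_on chart_image c \<and>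
     (\<forall>d\<in>coords A. \<forall>p \<in> fst c \<inter> fst d. \<phi> c p = \<phi> d p * transition_deriv c d p))"

text \<open>The sequence \<open>\<phi> 0, ..., \<phi> (q - 1)\<close> is a basis of \<open>H\<^sup>0(M, K)\<close>.\<close>

definition differential_basis ::
  "('a :: t2_space) chart set \<Rightarrow> nat \<Rightarrow> (nat \<Rightarrow> ('a, complex) form) \<Rightarrow> bool" where
  "differential_basis A q \<phi> \<longleftrightarrow>
     (\<forall>j<q. holomorphic_differential A (\<phi> j)) \<and>
     (\<forall>\<psi>. holomorphic_differential A \<psi> \<longrightarrow>
        (\<exists>!a :: nat \<Rightarrow> complex. (\<forall>j\<ge>q. a j = 0) \<and>
           (\<forall>c\<in>coords A. \<forall>p\<in>fst c. \<psi> c p = (\<Sum>j<q. a j * \<phi> j c p))))"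

definition has_genus :: "('a :: t2_space) chart set \<Rightarrow> nat \<Rightarrow> bool" where
  "has_genus A q \<longleftrightarrow> (\<exists>\<phi>. differential_basis A q \<phi>)"

text \<open>The pairing \<open>(i/2) \<integral> \<phi> \<and> \<psi>bar\<close>.\<close>

definition orthonormal_differential_basis ::
  "('a :: t2_space) chart set \<Rightarrow> nat \<Rightarrow> (nat \<Rightarrow> ('a, complex) form) \<Rightarrow> bool" where
  "orthonormal_differential_basis A q \<phi> \<longleftrightarrow> differential_basis A q \<phi> \<and>
     (\<forall>j<q. \<forall>k<q. form_has_integral A (\<lambda>c p. \<phi> j c p * cnj (\<phi> k c p)) (if j = k then 1 else 0))"

definition canonical_volume_form ::
  "('a :: t2_space) chart set \<Rightarrow> nat \<Rightarrow> ('a, real) form \<Rightarrow> bool" where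
  "canonical_volume_form A q \<omega> \<longleftrightarrow> (\<exists>\<phi>. orthonormal_differential_basis A q \<phi> \<and>
     (\<forall>c\<in>coords A. \<forall>p\<in>fst c. \<omega> c p = (\<Sum>j<q. (cmod (\<phi> j c p))\<^sup>2) / real q))"

section \<open>Normalized volume forms\<close>

text \<open>
  A Hermitian metric \<open>h dz \<otimes> dzbar\<close> on the open subset \<open>W\<close>; its volume form is
  \<open>h (i/2) dz \<and> dzbar\<close>, so that both have the same coefficients.
\<close>

definition hermitian_metric_on ::
  "('a :: t2_space) chart set \<Rightarrow> 'a set \<Rightarrow> ('a, real) form \<Rightarrow> bool" where
  "hermitian_metric_on A W h \<longleftrightarrow> (\<forall>c\<in>coords A.
     smooth_on (h c \<circ> chart_inv c) (snd c ` (fst c \<inter> W)) \<and>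
     (\<forall>p \<in> fst c \<inter> W. h c p > 0) \<and>
     (\<forall>d\<in>coords A. \<forall>p \<in> fst c \<inter> fst d \<inter> W. h c p = h d p * (cmod (transition_deriv c d p))\<^sup>2))"

definition quasi_hyperbolic ::
  "('a :: t2_space) chart set \<Rightarrow> 'a set \<Rightarrow> ('a, real) form \<Rightarrow> bool" where
  "quasi_hyperbolic A S h \<longleftrightarrow> finite S \<and> hermitian_metric_on A (- S) h \<and>
     (\<forall>P\<in>S. \<exists>c\<in>coords A. chart_image c = ball 0 1 \<and> fst c \<inter> S = {P} \<and> snd c P = 0 \<and>
       (\<exists>C1>0. \<exists>C2>0. \<exists>C3>0. \<exists>\<phi> :: complex \<Rightarrow> complex. smooth_on \<phi> (ball 0 1 - {0}) \<and>
         (\<forall>z \<in> ball 0 1 - {0}.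
            complex_of_real (h c (chart_inv c z)) = d_dz (d_dzbar \<phi>) z \<and>
            h c (chart_inv c z) \<le> C1 / ((cmod z)\<^sup>2 * (ln (cmod z))\<^sup>2) \<and>
            cmod (\<phi> z) \<le> C2 * max 1 (ln (- ln (cmod z))) \<and>
            cmod (d_dz \<phi> z) \<le> C3 / (cmod z * \<bar>ln (cmod z)\<bar>) \<and>
            cmod (d_dzbar \<phi> z) \<le> C3 / (cmod z * \<bar>ln (cmod z)\<bar>))))"

definition normalized_volume_form :: "('a :: t2_space) chart set \<Rightarrow> ('a, real) form \<Rightarrow> bool" where
  "normalized_volume_form A \<omega> \<longleftrightarrow>
     (\<exists>h. (hermitian_metric_on A UNIV h \<or> (\<exists>S. quasi_hyperbolic A S h)) \<and>
          (\<exists>s>0. \<forall>c p. \<omega> c p = s * h c p)) \<and>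
     form_has_integral A \<omega> 1"

section \<open>The Arakelov--Green function and the potential of a volume form\<close>

text \<open>The values \<open>g P P\<close> on the diagonal are unconstrained and irrelevant.\<close>

definition arakelov_green ::
  "('a :: t2_space) chart set \<Rightarrow> ('a, real) form \<Rightarrow> ('a \<Rightarrow> 'a \<Rightarrow> real) \<Rightarrow> bool" where
  "arakelov_green A \<omega>can g \<longleftrightarrow>
     (\<forall>P Q. g P Q = g Q P) \<and>
     (\<forall>c\<in>coords A. \<forall>d\<in>coords A.
        smooth_on (\<lambda>(x, y). g (chart_inv c x) (chart_inv d y))
          {(x, y). x \<in> chart_image c \<and> y \<in> chart_image d \<and> chart_inv c x \<noteq> chart_inv d y}) \<and>
     (\<forall>c\<in>coords A. \<forall>P\<in>fst c. \<exists>u. smooth_on u (chart_image c) \<and>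
        (\<forall>Q\<in>fst c - {P}. g P Q = - ln ((cmod (snd c Q - snd c P))\<^sup>2) + u (snd c Q))) \<and>
     (\<forall>P. has_ddc_current A (g P) (\<lambda>\<tau>. form_integral A (\<lambda>c p. \<tau> p * \<omega>can c p) - \<tau> P)) \<and>
     (\<forall>P. form_has_integral A (\<lambda>c p. g P p * \<omega>can c p) 0)"

text \<open>The function \<open>\<beta>\<close> is a representative of the unique almost-everywhere class.\<close>

definition volume_potential ::
  "('a :: t2_space) chart set \<Rightarrow> ('a, real) form \<Rightarrow> ('a, real) form \<Rightarrow> ('a \<Rightarrow> real) \<Rightarrow> bool" where
  "volume_potential A \<omega>can \<omega> \<beta> \<longleftrightarrow>
     locally_integrable A \<beta> \<and>
     has_ddc_current A \<beta> (\<lambda>\<tau>. form_integral A (\<lambda>c p. \<tau> p * (\<omega> c p - \<omega>can c p))) \<and>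
     form_has_integral A (\<lambda>c p. \<beta> p * (\<omega> c p + \<omega>can c p)) 0"

section \<open>Rational sections\<close>

text \<open>
  Meromorphic functions are complex valued, take the value 0 at their poles, and have no
  removable singularities; a function with these conventions is the zero function as soon as
  it vanishes identically near some point.
\<close>

definition meromorphic_function :: "('a :: t2_space) chart set \<Rightarrow> ('a \<Rightarrow> complex) \<Rightarrow> bool" where
  "meromorphic_function A f \<longleftrightarrow>
     (\<forall>c\<in>coords A. (f \<circ> chart_inv c) nicely_meromorphic_on chart_image c)"

definition nonzero_meromorphic :: "('a :: t2_space) chart set \<Rightarrow> ('a \<Rightarrow> complex) \<Rightarrow> bool" where
  "nonzero_meromorphic A f \<longleftrightarrow> meromorphic_function A f \<and> f \<noteq> (\<lambda>_. 0)"

definition order_at :: "('a :: t2_space) chart set \<Rightarrow> ('a \<Rightarrow> complex) \<Rightarrow> 'a \<Rightarrow> int" where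
  "order_at A f p =
     (THE n. \<forall>c\<in>coords A. p \<in> fst c \<longrightarrow> zorder (f \<circ> chart_inv c) (snd c p) = n)"

type_synonym 'a divisor = "'a \<Rightarrow> int"

definition divisor_support :: "'a divisor \<Rightarrow> 'a set" where
  "divisor_support D = {p. D p \<noteq> 0}"

definition divisor_degree :: "'a divisor \<Rightarrow> int" where
  "divisor_degree D = (\<Sum>p\<in>divisor_support D. D p)"

definition point_divisor :: "'a \<Rightarrow> 'a divisor" where
  "point_divisor P = (\<lambda>p. if p = P then 1 else 0)"

text \<open>
  Line bundles are given as \<open>O(D)\<close>. The rational sections of \<open>O(D)\<close> are the meromorphic
  functions, the function 1 being the canonical section \<open>1\<^sub>D\<close>, and the divisor of the section
  \<open>l\<close> is \<open>div l + D\<close>.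
\<close>

definition section_divisor ::
  "('a :: t2_space) chart set \<Rightarrow> 'a divisor \<Rightarrow> ('a \<Rightarrow> complex) \<Rightarrow> 'a divisor" where
  "section_divisor A D l p = order_at A l p + D p"

text \<open>\<open>f(div m)\<close> for a divisor \<open>div m\<close> disjoint from the one of \<open>f\<close>.\<close>

definition value_on_divisor :: "('a \<Rightarrow> complex) \<Rightarrow> 'a divisor \<Rightarrow> complex" where
  "value_on_divisor f D = (\<Prod>p\<in>divisor_support D. f p powi D p)"

text \<open>\<open>l' = f l\<close> as meromorphic functions; the pointwise identity may fail at zeros and poles.\<close>

definition is_product :: "('a \<Rightarrow> complex) \<Rightarrow> ('a \<Rightarrow> complex) \<Rightarrow> ('a \<Rightarrow> complex) \<Rightarrow> bool" where
  "is_product l' f l \<longleftrightarrow> finite {p. l' p \<noteq> f p * l p}"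

section \<open>The Deligne pairing\<close>

record 'v complex_space =
  vcarrier :: "'v set"
  vadd :: "'v \<Rightarrow> 'v \<Rightarrow> 'v"
  vscale :: "complex \<Rightarrow> 'v \<Rightarrow> 'v"

type_synonym 'a symbol = "('a \<Rightarrow> complex) \<times> ('a \<Rightarrow> complex)"

definition symbols ::
  "('a :: t2_space) chart set \<Rightarrow> 'a divisor \<Rightarrow> 'a divisor \<Rightarrow> 'a symbol set" where
  "symbols A D E = {(l, m). nonzero_meromorphic A l \<and> nonzero_meromorphic A m \<and>
     divisor_support (section_divisor A D l) \<inter> divisor_support (section_divisor A E m) = {}}"

text \<open>Scalar multiplication on the free complex vector space on a set.\<close>

definition free_scale :: "complex \<Rightarrow> ('s \<Rightarrow>\<^sub>0 complex) \<Rightarrow> ('s \<Rightarrow>\<^sub>0 complex)" where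
  "free_scale a x = Poly_Mapping.map ((*) a) x"

definition relations ::
  "('a :: t2_space) chart set \<Rightarrow> 'a divisor \<Rightarrow> 'a divisor \<Rightarrow> ('a symbol \<Rightarrow>\<^sub>0 complex) set" where
  "relations A D E =
     {Poly_Mapping.single (l', m) 1 -
        Poly_Mapping.single (l, m) (value_on_divisor f (section_divisor A E m)) | l' l f m.
        (l, m) \<in> symbols A D E \<and> (l', m) \<in> symbols A D E \<and>
        nonzero_meromorphic A f \<and> is_product l' f l} \<union>
     {Poly_Mapping.single (l, m') 1 -
        Poly_Mapping.single (l, m) (value_on_divisor f (section_divisor A D l)) | l m' m f.
        (l, m) \<in> symbols A D E \<and> (l, m') \<in> symbols A D E \<and>
        nonzero_meromorphic A f \<and> is_product m' f m}"

definition relation_space ::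
  "('a :: t2_space) chart set \<Rightarrow> 'a divisor \<Rightarrow> 'a divisor \<Rightarrow> ('a symbol \<Rightarrow>\<^sub>0 complex) set" where
  "relation_space A D E = {(\<Sum>r\<in>T. free_scale (a r) r) | T a. finite T \<and> T \<subseteq> relations A D E}"

definition relation_class ::
  "('a :: t2_space) chart set \<Rightarrow> 'a divisor \<Rightarrow> 'a divisor \<Rightarrow>
     ('a symbol \<Rightarrow>\<^sub>0 complex) \<Rightarrow> ('a symbol \<Rightarrow>\<^sub>0 complex) set" where
  "relation_class A D E x = {x + r | r. r \<in> relation_space A D E}"

text \<open>
  The pairing of \<open>O(D)\<close> and \<open>O(E)\<close>: the quotient of the free vector space on the symbols by
  the relations. In \<open>vscale\<close>, adding the relations keeps the result a full coset when \<open>a = 0\<close>.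
\<close>

definition deligne_pairing ::
  "('a :: t2_space) chart set \<Rightarrow> 'a divisor \<Rightarrow> 'a divisor \<Rightarrow>
     ('a symbol \<Rightarrow>\<^sub>0 complex) set complex_space" where
  "deligne_pairing A D E =
     \<lparr> vcarrier = relation_class A D E ` {x. Poly_Mapping.keys x \<subseteq> symbols A D E},
       vadd = (\<lambda>X Y. {x + y | x y. x \<in> X \<and> y \<in> Y}),
       vscale = (\<lambda>a X. {free_scale a x + r | x r. x \<in> X \<and> r \<in> relation_space A D E}) \<rparr>"

definition deligne_symbol ::
  "('a :: t2_space) chart set \<Rightarrow> 'a divisor \<Rightarrow> 'a divisor \<Rightarrow>
     ('a \<Rightarrow> complex) \<Rightarrow> ('a \<Rightarrow> complex) \<Rightarrow> ('a symbol \<Rightarrow>\<^sub>0 complex) set" where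
  "deligne_symbol A D E l m = relation_class A D E (Poly_Mapping.single (l, m) 1)"

section \<open>Metrized lines\<close>

definition complex_line :: "'v complex_space \<Rightarrow> bool" where
  "complex_line V \<longleftrightarrow> (\<exists>e\<in>vcarrier V. \<forall>v\<in>vcarrier V. \<exists>!a. v = vscale V a e)"

text \<open>Here \<open>vscale V 0 v\<close> is the zero vector.\<close>

definition metrized_line :: "'v complex_space \<Rightarrow> ('v \<Rightarrow> real) \<Rightarrow> bool" where
  "metrized_line V N \<longleftrightarrow> complex_line V \<and>
     (\<forall>v\<in>vcarrier V. N v \<ge> 0 \<and> (N v = 0 \<longleftrightarrow> v = vscale V 0 v)) \<and>
     (\<forall>a. \<forall>v\<in>vcarrier V. N (vscale V a v) = cmod a * N v) \<and>
     (\<forall>v\<in>vcarrier V. \<forall>w\<in>vcarrier V. N (vadd V v w) \<le> N v + N w)"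

definition isometry_of_lines ::
  "'v complex_space \<Rightarrow> ('v \<Rightarrow> real) \<Rightarrow> 'w complex_space \<Rightarrow> ('w \<Rightarrow> real) \<Rightarrow> ('v \<Rightarrow> 'w) \<Rightarrow> bool" where
  "isometry_of_lines V N W N' F \<longleftrightarrow>
     metrized_line V N \<and> metrized_line W N' \<and>
     bij_betw F (vcarrier V) (vcarrier W) \<and>
     (\<forall>v\<in>vcarrier V. \<forall>w\<in>vcarrier V. F (vadd V v w) = vadd W (F v) (F w)) \<and>
     (\<forall>a. \<forall>v\<in>vcarrier V. F (vscale V a v) = vscale W a (F v)) \<and>
     (\<forall>v\<in>vcarrier V. N' (F v) = N v)"

section \<open>Arakelov metrics and the Deligne norm\<close>

text \<open>
  A metrized line bundle is a pair of a divisor \<open>D\<close> and the function \<open>h = \<parallel>1\<^sub>D\<parallel>\<^sup>2\<close> outside the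
  support of \<open>D\<close>.
\<close>

type_synonym 'a metrized_bundle = "'a divisor \<times> ('a \<Rightarrow> real)"

definition arakelov_norm2 :: "('a \<Rightarrow> 'a \<Rightarrow> real) \<Rightarrow> ('a \<Rightarrow> real) \<Rightarrow> 'a \<Rightarrow> 'a \<Rightarrow> real" where
  "arakelov_norm2 g \<beta> P Q = exp (- g P Q - \<beta> Q)"

definition arakelov_bundle ::
  "('a \<Rightarrow> 'a \<Rightarrow> real) \<Rightarrow> ('a \<Rightarrow> real) \<Rightarrow> 'a \<Rightarrow> 'a metrized_bundle" where
  "arakelov_bundle g \<beta> P = (point_divisor P, arakelov_norm2 g \<beta> P)"

text \<open>
  The relation \<open>\<parallel>l\<parallel>\<^sup>2 = e\<^sup>c \<Prod> \<parallel>1\<^bsub>A\<^sub>i\<^esub>\<parallel>\<^bsup>2 n\<^sub>i\<^esup>\<close> for \<open>div l = \<Sum> n\<^sub>i A\<^sub>i\<close>. For an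
  admissible metric \<open>c\<close> exists because both sides have the same curvature.
\<close>

definition section_constant ::
  "('a :: t2_space) chart set \<Rightarrow> ('a \<Rightarrow> 'a \<Rightarrow> real) \<Rightarrow> ('a \<Rightarrow> real) \<Rightarrow> 'a metrized_bundle \<Rightarrow>
     ('a \<Rightarrow> complex) \<Rightarrow> real \<Rightarrow> bool" where
  "section_constant A g \<beta> L l c \<longleftrightarrow> (let \<delta> = section_divisor A (fst L) l in
     \<forall>Q. Q \<notin> divisor_support (fst L) \<longrightarrow> Q \<notin> divisor_support \<delta> \<longrightarrow>
       (cmod (l Q))\<^sup>2 * snd L Q =
         exp c * (\<Prod>B\<in>divisor_support \<delta>. arakelov_norm2 g \<beta> B Q powi \<delta> B))"

text \<open>
  \<open>N\<close> is the Deligne norm on the pairing of the admissible bundles \<open>L\<close> and \<open>L'\<close>, for the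
  volume form with potential \<open>\<beta>\<close>. The formula is not written with \<open>ln\<close>, as \<open>ln 0 = 0\<close>.
\<close>

definition deligne_norm ::
  "('a :: t2_space) chart set \<Rightarrow> ('a \<Rightarrow> 'a \<Rightarrow> real) \<Rightarrow> ('a \<Rightarrow> real) \<Rightarrow>
     'a metrized_bundle \<Rightarrow> 'a metrized_bundle \<Rightarrow> (('a symbol \<Rightarrow>\<^sub>0 complex) set \<Rightarrow> real) \<Rightarrow> bool" where
  "deligne_norm A g \<beta> L L' N \<longleftrightarrow>
     metrized_line (deligne_pairing A (fst L) (fst L')) N \<and>
     (\<forall>l m c c'. (l, m) \<in> symbols A (fst L) (fst L') \<longrightarrow>
        section_constant A g \<beta> L l c \<longrightarrow> section_constant A g \<beta> L' m c' \<longrightarrow>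
        (let \<delta> = section_divisor A (fst L) l; \<epsilon> = section_divisor A (fst L') m in
          (N (deligne_symbol A (fst L) (fst L') l m))\<^sup>2 =
            exp (- (\<Sum>B\<in>divisor_support \<delta>. \<Sum>C\<in>divisor_support \<epsilon>. of_int (\<delta> B * \<epsilon> C) * g B C)
              + c * of_int (divisor_degree (fst L')) + c' * of_int (divisor_degree (fst L)))))"

end

theory Submission
  imports Defs
begin

text \<open>
  The Deligne pairing does not depend on the metrics, and a norm on a complex line is determined
  by its value on one nonzero vector (\<open>metrized_line_norm_unique\<close>). The symbol of the canonical
  sections \<open>1\<^sub>P\<close> and \<open>1\<^sub>Q\<close> is such a vector: since \<open>P \<noteq> Q\<close> their divisors are disjoint, and in
  the \<open>\<omega>\<close>-Arakelov metrics the constants of these sections are 0, so the Deligne norm satisfies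
  \<open>\<parallel>\<langle>1\<^sub>P, 1\<^sub>Q\<rangle>\<parallel>\<^sup>2 = exp (- g P Q)\<close> (\<open>deligne_norm_canonical_symbol\<close>). The potential of \<open>\<omega>\<close>
  enters both sides of \<open>\<parallel>1\<^sub>P\<parallel>\<^sup>2 = e\<^sup>c \<parallel>1\<^sub>P\<parallel>\<^sup>2\<close> alike, which forces \<open>c = 0\<close>, so that
  the value involves only the Green function, which is the same for all volume forms.
\<close>

lemma atlas_subset_coords: "riemann_surface A \<Longrightarrow> A \<subseteq> coords A"
  unfolding riemann_surface_def coords_def by blast

lemma coords_cover:
  assumes "riemann_surface A"
  obtains c where "c \<in> coords A" "p \<in> fst c"
  using assms atlas_subset_coords[OF assms] unfolding riemann_surface_def by blast

lemma nonzero_meromorphic_one: "nonzero_meromorphic A (\<lambda>_. 1)"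
proof -
  have "(\<lambda>_. 1 :: complex) nicely_meromorphic_on S" for S
    by (intro analytic_on_imp_nicely_meromorphic_on analytic_intros)
  then show ?thesis
    by (auto simp: nonzero_meromorphic_def meromorphic_function_def comp_def fun_eq_iff)
qed

lemma order_at_one:
  assumes "riemann_surface A"
  shows "order_at A (\<lambda>_. 1) p = 0"
proof -
  obtain c where c: "c \<in> coords A" "p \<in> fst c"
    using coords_cover[OF assms] .
  from c show ?thesis
    unfolding order_at_def by (intro the_equality) (auto simp: comp_def)
qed

lemma section_divisor_one:
  assumes "riemann_surface A"
  shows "section_divisor A D (\<lambda>_. 1) = D"
  by (simp add: fun_eq_iff section_divisor_def order_at_one[OF assms])

lemma divisor_support_point: "divisor_support (point_divisor P) = {P}"
  by (auto simp: divisor_support_def point_divisor_def)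

lemma point_divisor_self: "point_divisor P P = 1"
  by (simp add: point_divisor_def)

lemma canonical_symbol_in_symbols:
  assumes "riemann_surface A" and "P \<noteq> Q"
  shows "((\<lambda>_. 1), (\<lambda>_. 1)) \<in> symbols A (point_divisor P) (point_divisor Q)"
  using assms by (simp add: symbols_def nonzero_meromorphic_one section_divisor_one
      divisor_support_point)

lemma deligne_symbol_in_carrier:
  assumes "(l, m) \<in> symbols A D E"
  shows "deligne_symbol A D E l m \<in> vcarrier (deligne_pairing A D E)"
  using assms by (auto simp: deligne_symbol_def deligne_pairing_def)

text \<open>For the section 1 of \<open>O(P)\<close> both sides of the defining relation are \<open>\<parallel>1\<^sub>P\<parallel>\<^sup>2\<close>.\<close>

lemma section_constant_canonical_section:
  assumes "riemann_surface A"
  shows "section_constant A g \<beta> (arakelov_bundle g \<beta> P) (\<lambda>_. 1) 0"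
  by (simp add: section_constant_def arakelov_bundle_def section_divisor_one[OF assms]
      divisor_support_point point_divisor_self)

lemma deligne_norm_canonical_symbol:
  assumes "riemann_surface A" and "P \<noteq> Q"
    and "deligne_norm A g \<beta> (arakelov_bundle g \<beta> P) (arakelov_bundle g \<beta> Q) N"
  shows "(N (deligne_symbol A (point_divisor P) (point_divisor Q) (\<lambda>_. 1) (\<lambda>_. 1)))\<^sup>2
    = exp (- g P Q)"
proof -
  let ?L = "arakelov_bundle g \<beta> P" and ?L' = "arakelov_bundle g \<beta> Q"
  have fst: "fst ?L = point_divisor P" "fst ?L' = point_divisor Q"
    by (simp_all add: arakelov_bundle_def)
  have sym: "((\<lambda>_. 1), (\<lambda>_. 1)) \<in> symbols A (fst ?L) (fst ?L')"
    unfolding fst by (rule canonical_symbol_in_symbols[OF assms(1,2)])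
  note const = section_constant_canonical_section[OF assms(1), of g \<beta>]
  show ?thesis
    using assms(3)[unfolded deligne_norm_def, THEN conjunct2, rule_format, OF sym const const]
    by (simp add: fst section_divisor_one[OF assms(1)] divisor_support_point
        point_divisor_self)
qed

text \<open>Only the homogeneity of the norms is used: every vector is a multiple of one generator.\<close>

lemma metrized_line_norm_unique:
  assumes N: "metrized_line V N" and N': "metrized_line V N'"
    and s: "s \<in> vcarrier V" "N s = N' s" "N s \<noteq> 0"
    and v: "v \<in> vcarrier V"
  shows "N v = N' v"
proof -
  obtain e where e: "e \<in> vcarrier V" "\<And>w. w \<in> vcarrier V \<Longrightarrow> \<exists>a. w = vscale V a e"
    using N unfolding metrized_line_def complex_line_def by (metis (no_types))
  obtain a where a: "s = vscale V a e" using e(2) s(1) by blast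
  obtain b where b: "v = vscale V b e" using e(2) v by blast
  have scale: "N (vscale V t e) = cmod t * N e" "N' (vscale V t e) = cmod t * N' e" for t
    using N N' e(1) by (simp_all add: metrized_line_def)
  have "cmod a * N e = cmod a * N' e" "cmod a * N e \<noteq> 0"
    using s(2,3) unfolding a scale .
  then have "N e = N' e" by simp
  then show ?thesis unfolding b scale by simp
qed

theorem proposition2p5p1:
  fixes A :: "('a :: t2_space) chart set" and q :: nat
    and \<omega>can \<omega>1 \<omega>2 :: "('a, real) form"
    and g :: "'a \<Rightarrow> 'a \<Rightarrow> real" and \<beta>1 \<beta>2 :: "'a \<Rightarrow> real"
    and P Q :: 'a
    and N1 N2 :: "('a symbol \<Rightarrow>\<^sub>0 complex) set \<Rightarrow> real"
  assumes "compact_connected_riemann_surface A" and "has_genus A q" and "q \<ge> 1"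
    and "canonical_volume_form A q \<omega>can"
    and "arakelov_green A \<omega>can g"
    and "normalized_volume_form A \<omega>1" and "normalized_volume_form A \<omega>2"
    and "volume_potential A \<omega>can \<omega>1 \<beta>1" and "volume_potential A \<omega>can \<omega>2 \<beta>2"
    and "P \<noteq> Q"
    and "deligne_norm A g \<beta>1 (arakelov_bundle g \<beta>1 P) (arakelov_bundle g \<beta>1 Q) N1"
    and "deligne_norm A g \<beta>2 (arakelov_bundle g \<beta>2 P) (arakelov_bundle g \<beta>2 Q) N2"
  shows "isometry_of_lines (deligne_pairing A (point_divisor P) (point_divisor Q)) N1
           (deligne_pairing A (point_divisor P) (point_divisor Q)) N2 id"
proof -
  let ?V = "deligne_pairing A (point_divisor P) (point_divisor Q)"
  let ?s = "deligne_symbol A (point_divisor P) (point_divisor Q) (\<lambda>_. 1) (\<lambda>_. 1)"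
  have A: "riemann_surface A"
    using assms(1) by (simp add: compact_connected_riemann_surface_def)
  have line: "metrized_line ?V N1" "metrized_line ?V N2"
    using assms(11,12) by (simp_all add: deligne_norm_def arakelov_bundle_def)
  have s: "?s \<in> vcarrier ?V"
    by (intro deligne_symbol_in_carrier canonical_symbol_in_symbols A assms(10))
  have nonneg: "N1 ?s \<ge> 0" "N2 ?s \<ge> 0"
    using line s by (simp_all add: metrized_line_def)
  have sq: "(N1 ?s)\<^sup>2 = exp (- g P Q)" "(N2 ?s)\<^sup>2 = exp (- g P Q)"
    using deligne_norm_canonical_symbol[OF A assms(10)] assms(11,12) by blast+
  have "N1 ?s = N2 ?s"
    using sq nonneg by (metis power2_eq_imp_eq)
  moreover have "N1 ?s \<noteq> 0"
    using sq(1) by auto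
  ultimately have "N1 v = N2 v" if "v \<in> vcarrier ?V" for v
    using metrized_line_norm_unique[OF line s] that by blast
  then show ?thesis
    using line by (simp add: isometry_of_lines_def)
qed

end
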